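(* Let $\mathcal{F}=\{F_i : i\in\mathbb{N}\}$ be a countable family of contraction maps on the complete metric space $(X,d)$. If $r:=\sup_{i\in\mathbb{N}}\mathrm{Lip}(F_i)<1$ and the set $D$ of fixed points of elements of $\mathcal{F}$ is bounded, then $\overline{P}$ is the unique bounded invariant set for $\mathcal{F}$, where $P$ is the set of fixed points of finite compositions of members of $\mathcal{F}$.
   Context: A map $F:X\to X$ is a contraction if there is a constant $c$ with $0<c<1$ such that $d(F(x),F(y))\le c\,d(x,y)$ for all $x,y\in X$; $\mathrm{Lip}(F)$ denotes the smallest Lipschitz constant of $F$. $D=\{x_i : i\in\mathbb{N}\}$ where $x_i$ is the fixed point of $F_i$. $P$ is the set of all points $x\in X$ such that $F_{i_1}\circ\dots\circ F_{i_k}(x)=x$ for some $k\ge 1$ and some $i_1,\dots,i_k\in\mathbb{N}$. A non-empty set $E\subset X$ is an invariant set for $\mathcal{F}$ if $E=\overline{\bigcup_{i=1}^\infty F_i(E)}$. *)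

theory Defs
  imports "HOL-Analysis.Analysis"
begin

definition contraction_map :: "('a::metric_space \<Rightarrow> 'a) \<Rightarrow> bool" where
  "contraction_map f \<longleftrightarrow> (\<exists>c. 0 < c \<and> c < 1 \<and> (\<forall>x y. dist (f x) (f y) \<le> c * dist x y))"

(* Meaningful for Lipschitz maps only; the minimum is over nonnegative constants, since
   lipschitz_on requires nonnegativity (this matters only on a one-point space). *)
definition Lip :: "('a::metric_space \<Rightarrow> 'a) \<Rightarrow> real" where
  "Lip f = (LEAST c. c-lipschitz_on UNIV f)"

(* The description is proper for contractions of a complete space, by the Banach fixed point
   theorem. *)
definition the_fixed_point :: "('a \<Rightarrow> 'a) \<Rightarrow> 'a" where
  "the_fixed_point f = (THE x. f x = x)"

definition fixed_points :: "(nat \<Rightarrow> 'a \<Rightarrow> 'a) \<Rightarrow> 'a set" where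
  "fixed_points F = {the_fixed_point (F i) | i. True}"

(* The word [i1, ..., ik] stands for F i1 \<circ> ... \<circ> F ik. *)
definition compose_word :: "(nat \<Rightarrow> 'a \<Rightarrow> 'a) \<Rightarrow> nat list \<Rightarrow> 'a \<Rightarrow> 'a" where
  "compose_word F w = foldr (\<circ>) (map F w) id"

definition composition_fixed_points :: "(nat \<Rightarrow> 'a \<Rightarrow> 'a) \<Rightarrow> 'a set" where
  "composition_fixed_points F = {x. \<exists>w. w \<noteq> [] \<and> compose_word F w x = x}"

definition invariant_set :: "(nat \<Rightarrow> 'a::metric_space \<Rightarrow> 'a) \<Rightarrow> 'a set \<Rightarrow> bool" where
  "invariant_set F E \<longleftrightarrow> E \<noteq> {} \<and> E = closure (\<Union>i. F i ` E)"

end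

theory Submission
  imports Defs
begin

text \<open>
  Let \<open>r < 1\<close> be the supremum of the Lipschitz constants. A word of length \<open>n\<close> contracts by
  \<open>r ^ n\<close>, and statements about compositions become statements about \<open>r ^ n\<close> tending to zero.

  Boundedness. Since the fixed points of the single maps lie in a ball \<open>cball a R\<close>, every map sends
  the ball about \<open>a\<close> of radius \<open>(1 + r) * R / (1 - r)\<close> into itself (\<open>common_invariant_ball\<close>).
  Compositions do so as well, and by Banach's theorem their fixed points lie in that ball.

  Invariance. Write \<open>P\<close> for the set of fixed points of compositions. If the word \<open>i # w\<close> fixes \<open>x\<close>,
  then the rotated word \<open>w @ [i]\<close> fixes the image \<open>y\<close> of \<open>x\<close> under \<open>w\<close>, and \<open>x = F i y\<close>; so every
  point of \<open>P\<close> is an image of a point of \<open>P\<close> (\<open>composition_fixed_points_subset_images\<close>).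
  Conversely, if \<open>w\<close> fixes \<open>x\<close>, then \<open>F i x\<close> is, for every \<open>n\<close>, the image of \<open>x\<close> under the word that
  starts with \<open>i\<close> and continues with \<open>n\<close> copies of \<open>w\<close>. The fixed points of these long words lie in
  the bounded set \<open>P\<close>, hence converge to \<open>F i x\<close> (\<open>image_composition_fixed_points_subset\<close>).

  Uniqueness. Let \<open>E\<close> be bounded and covered, up to closure, by its images, and let \<open>K\<close> be
  non-empty and mapped into itself. A point of \<open>E\<close> is nearly \<open>F i e\<close> with \<open>e \<in> E\<close>, whose distance
  to \<open>K\<close> is at most \<open>r\<close> times that of \<open>e\<close>. Iterating, the distance of \<open>E\<close> to \<open>K\<close> vanishes, so
  \<open>E \<subseteq> closure K\<close> (\<open>covered_subset_closure_of_forward_invariant\<close>). A bounded invariant set can play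
  either role, so two such sets contain each other.
\<close>

section \<open>Words\<close>

lemma compose_word_Nil [simp]: "compose_word F [] x = x"
  by (simp add: compose_word_def)

lemma compose_word_Cons [simp]: "compose_word F (i # w) x = F i (compose_word F w x)"
  by (simp add: compose_word_def)

lemma compose_word_append [simp]:
  "compose_word F (v @ w) x = compose_word F v (compose_word F w x)"
  by (induction v) auto

lemma compose_word_replicate_fixed:
  assumes "compose_word F w x = x"
  shows "compose_word F (concat (replicate n w)) x = x"
  by (induction n) (auto simp: assms)

lemma compose_word_maps_into:
  assumes "\<And>i. F i ` B \<subseteq> B" "x \<in> B"
  shows "compose_word F w x \<in> B"
  using assms by (induction w) auto

text \<open>If \<open>f \<circ> g\<close> fixes \<open>x\<close>, then \<open>g \<circ> f\<close> fixes \<open>g x\<close>, and \<open>f\<close> takes \<open>g x\<close> back to \<open>x\<close>. Here \<open>f\<close> is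
  the first letter of a word and \<open>g\<close> the composition of the rest.\<close>

lemma composition_fixed_points_subset_images:
  "composition_fixed_points F \<subseteq> (\<Union>i. F i ` composition_fixed_points F)"
proof
  fix x assume "x \<in> composition_fixed_points F"
  then obtain i w where fixed: "compose_word F (i # w) x = x"
    unfolding composition_fixed_points_def by (auto simp: neq_Nil_conv)
  have "compose_word F (w @ [i]) (compose_word F w x) = compose_word F w x"
    using fixed by simp
  then have "compose_word F w x \<in> composition_fixed_points F"
    unfolding composition_fixed_points_def by blast
  moreover have "x = F i (compose_word F w x)"
    using fixed by simp
  ultimately show "x \<in> (\<Union>i. F i ` composition_fixed_points F)"
    by blast
qed

section \<open>Families with a common contraction factor\<close>

locale uniform_contractions =
  fixes F :: "nat \<Rightarrow> 'a::complete_space \<Rightarrow> 'a" and r :: real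
  assumes r_nonneg: "0 \<le> r" and r_less_1: "r < 1"
    and contracts: "dist (F i x) (F i y) \<le> r * dist x y"
begin

lemma compose_word_contracts:
  "dist (compose_word F w x) (compose_word F w y) \<le> r ^ length w * dist x y"
proof (induction w)
  case (Cons i w)
  have "dist (compose_word F (i # w) x) (compose_word F (i # w) y)
      \<le> r * dist (compose_word F w x) (compose_word F w y)"
    using contracts by simp
  also have "\<dots> \<le> r * (r ^ length w * dist x y)"
    using Cons r_nonneg by (intro mult_left_mono)
  finally show ?case by (simp add: mult.assoc)
qed simp

lemma compose_word_ex1_fixed_in:
  assumes "complete B" "B \<noteq> {}" "\<And>i. F i ` B \<subseteq> B" "w \<noteq> []"
  shows "\<exists>!x\<in>B. compose_word F w x = x"
proof (rule Banach_fix)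
  show "r ^ length w < 1"
    using r_nonneg r_less_1 assms(4) by (simp add: power_less_one_iff)
  show "compose_word F w ` B \<subseteq> B"
    by (intro image_subsetI compose_word_maps_into assms(3))
  show "0 \<le> r ^ length w"
    using r_nonneg by simp
qed (rule assms compose_word_contracts)+

lemma compose_word_ex1_fixed:
  "w \<noteq> [] \<Longrightarrow> \<exists>!x. compose_word F w x = x"
  using compose_word_ex1_fixed_in [of UNIV w] by (simp add: complete_UNIV)

lemma map_the_fixed_point: "F i (the_fixed_point (F i)) = the_fixed_point (F i)"
  using theI' [of "\<lambda>x. F i x = x"] compose_word_ex1_fixed [of "[i]"]
  unfolding the_fixed_point_def by simp

lemma composition_fixed_points_subset:
  assumes "complete B" "B \<noteq> {}" "\<And>i. F i ` B \<subseteq> B"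
  shows "composition_fixed_points F \<subseteq> B"
proof
  fix x assume "x \<in> composition_fixed_points F"
  then obtain w where w: "w \<noteq> []" "compose_word F w x = x"
    unfolding composition_fixed_points_def by blast
  obtain y where "y \<in> B" "compose_word F w y = y"
    using compose_word_ex1_fixed_in [OF assms w(1)] by blast
  with w show "x \<in> B"
    using compose_word_ex1_fixed by metis
qed

lemma composition_fixed_points_nonempty: "composition_fixed_points F \<noteq> {}"
  using compose_word_ex1_fixed [of "[0]"] unfolding composition_fixed_points_def by blast

text \<open>The radius \<open>(1 + r) * R / (1 - r)\<close> solves \<open>r * (\<rho> + R) + R = \<rho>\<close>, where the left side bounds
  the distance from the centre to the image of a point at distance at most \<open>\<rho>\<close>: compare both with
  the fixed point of the map.\<close>

lemma common_invariant_ball: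
  assumes "bounded (fixed_points F)"
  obtains a \<rho> where "0 \<le> \<rho>" "\<And>i. F i ` cball a \<rho> \<subseteq> cball a \<rho>"
proof -
  obtain a R where R: "\<And>x. x \<in> fixed_points F \<Longrightarrow> dist a x \<le> R"
    using assms unfolding bounded_def by blast
  have near: "dist a (the_fixed_point (F i)) \<le> R" for i
    using R unfolding fixed_points_def by blast
  have R_nonneg: "0 \<le> R"
    using near [of 0] zero_le_dist order_trans by blast
  define \<rho> where "\<rho> = (1 + r) * R / (1 - r)"
  have \<rho>: "r * (\<rho> + R) + R = \<rho>"
    using r_less_1 unfolding \<rho>_def by (simp add: field_simps)
  have "dist a (F i x) \<le> \<rho>" if x: "dist a x \<le> \<rho>" for i x
  proof -
    let ?p = "the_fixed_point (F i)"
    have "dist ?p x \<le> \<rho> + R"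
      using near [of i] x dist_triangle3 [of ?p x a] by linarith
    then have "dist ?p (F i x) \<le> r * (\<rho> + R)"
      using contracts [of i ?p x] mult_left_mono [OF _ r_nonneg] map_the_fixed_point [of i]
      by (metis order_trans)
    then show ?thesis
      using near [of i] dist_triangle [of a "F i x" ?p] \<rho> by linarith
  qed
  then have "F i ` cball a \<rho> \<subseteq> cball a \<rho>" for i
    by (simp add: image_subset_iff)
  moreover have "0 \<le> \<rho>"
    using r_nonneg r_less_1 R_nonneg unfolding \<rho>_def by simp
  ultimately show ?thesis
    by (rule that [rotated])
qed

lemma bounded_composition_fixed_points:
  assumes "bounded (fixed_points F)"
  shows "bounded (composition_fixed_points F)"
proof -
  obtain a \<rho> where "0 \<le> \<rho>" "\<And>i. F i ` cball a \<rho> \<subseteq> cball a \<rho>"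
    using common_invariant_ball [OF assms] by metis
  then have "composition_fixed_points F \<subseteq> cball a \<rho>"
    by (intro composition_fixed_points_subset) (simp_all add: complete_eq_closed)
  then show ?thesis
    using bounded_subset bounded_cball by blast
qed

lemma image_closure_subset_closure:
  assumes "F i ` A \<subseteq> closure B"
  shows "F i ` closure A \<subseteq> closure B"
proof -
  have "r-lipschitz_on (closure A) (F i)"
    using contracts r_nonneg by (intro lipschitz_onI)
  then show ?thesis
    using assms by (intro image_closure_subset lipschitz_on_continuous_on) auto
qed

text \<open>This is the inclusion that needs boundedness: the approximating fixed points, of \<open>i\<close> followed
  by \<open>n\<close> copies of \<open>w\<close>, must stay at bounded distance from \<open>x\<close> for the factor \<open>r ^ n\<close> to win.\<close>

lemma image_composition_fixed_points_subset:
  assumes "bounded (composition_fixed_points F)"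
  shows "F i ` composition_fixed_points F \<subseteq> closure (composition_fixed_points F)"
proof clarify
  fix x assume x: "x \<in> composition_fixed_points F"
  then obtain w where w: "w \<noteq> []" "compose_word F w x = x"
    unfolding composition_fixed_points_def by blast
  obtain C where C: "\<And>y. y \<in> composition_fixed_points F \<Longrightarrow> dist x y \<le> C"
    using assms bounded_any_center [of _ x] by auto
  have "\<exists>y\<in>composition_fixed_points F. dist y (F i x) \<le> r ^ n * C" for n
  proof -
    define v where "v = i # concat (replicate n w)"
    have v_x: "compose_word F v x = F i x"
      unfolding v_def by (simp add: compose_word_replicate_fixed w(2))
    have "length v = Suc (n * length w)"
      unfolding v_def by (simp add: length_concat sum_list_replicate)
    moreover have "n * 1 \<le> n * length w"
      using w(1) by (intro mult_le_mono2) (simp add: Suc_le_eq)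
    ultimately have v_length: "n \<le> length v"
      by linarith
    obtain y where y: "compose_word F v y = y"
      using compose_word_ex1_fixed [of v] unfolding v_def by blast
    then have y_P: "y \<in> composition_fixed_points F"
      unfolding composition_fixed_points_def v_def by blast
    have "dist y (F i x) \<le> r ^ length v * dist x y"
      using compose_word_contracts [of v y x] by (simp add: y v_x dist_commute)
    also have "\<dots> \<le> r ^ n * C"
      using v_length r_nonneg r_less_1 C [OF y_P]
      by (intro mult_mono power_decreasing) auto
    finally show ?thesis
      using y_P by blast
  qed
  then obtain y where y: "\<And>n. y n \<in> composition_fixed_points F"
      "\<And>n. dist (y n) (F i x) \<le> r ^ n * C"
    by metis
  have "(\<lambda>n. r ^ n * C) \<longlonglongrightarrow> 0"
    using r_nonneg r_less_1 by (intro tendsto_mult_left_zero LIMSEQ_power_zero) simp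
  then have "(\<lambda>n. dist (y n) (F i x)) \<longlonglongrightarrow> 0"
    by (rule tendsto_sandwich [OF _ _ tendsto_const, rotated 2]) (use y(2) in auto)
  then have "y \<longlonglongrightarrow> F i x"
    using tendsto_dist_iff by blast
  then show "F i x \<in> closure (composition_fixed_points F)"
    using y(1) closure_sequential by blast
qed

lemma invariant_set_closure_composition_fixed_points:
  assumes "bounded (composition_fixed_points F)"
  shows "invariant_set F (closure (composition_fixed_points F))"
proof -
  let ?P = "composition_fixed_points F"
  have "F i ` closure ?P \<subseteq> closure ?P" for i
    using image_composition_fixed_points_subset [OF assms] by (rule image_closure_subset_closure)
  then have "closure (\<Union>i. F i ` closure ?P) \<subseteq> closure ?P"
    by (intro closure_minimal) auto
  moreover have "?P \<subseteq> (\<Union>i. F i ` closure ?P)"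
    by (rule subset_trans [OF composition_fixed_points_subset_images])
      (intro UN_mono image_mono closure_subset order_refl)
  then have "closure ?P \<subseteq> closure (\<Union>i. F i ` closure ?P)"
    by (rule closure_mono)
  ultimately show ?thesis
    using composition_fixed_points_nonempty unfolding invariant_set_def by auto
qed

lemma infdist_image_le:
  assumes "F i ` K \<subseteq> K" "K \<noteq> {}"
  shows "infdist (F i e) K \<le> r * infdist e K"
proof (rule field_le_epsilon)
  fix \<epsilon> :: real assume "0 < \<epsilon>"
  then obtain k where k: "k \<in> K" "dist e k < infdist e K + \<epsilon>"
    using cInf_lessD [of "dist e ` K" "infdist e K + \<epsilon>"] assms(2)
    unfolding infdist_notempty [OF assms(2)] by auto
  have "infdist (F i e) K \<le> dist (F i e) (F i k)"
    using assms(1) k(1) by (intro infdist_le) auto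
  also have "\<dots> \<le> r * dist e k"
    by (rule contracts)
  also have "\<dots> \<le> r * (infdist e K + \<epsilon>)"
    using k(2) r_nonneg by (intro mult_left_mono) auto
  also have "\<dots> \<le> r * infdist e K + \<epsilon>"
    using r_less_1 \<open>0 < \<epsilon>\<close> by (simp add: distrib_left mult_left_le_one_le r_nonneg)
  finally show "infdist (F i e) K \<le> r * infdist e K + \<epsilon>" .
qed

text \<open>The sets \<open>E\<close> and \<open>K\<close> each satisfy one of the two inclusions that make up invariance, so that
  exchanging the roles of two bounded invariant sets gives their equality.\<close>

lemma covered_subset_closure_of_forward_invariant:
  assumes "bounded E" "E \<subseteq> closure (\<Union>i. F i ` E)"
    and "K \<noteq> {}" "\<And>i. F i ` K \<subseteq> K"
  shows "E \<subseteq> closure K"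
proof
  obtain C where C: "\<And>e. e \<in> E \<Longrightarrow> infdist e K \<le> C"
  proof -
    obtain k where "k \<in> K" using assms(3) by blast
    moreover obtain C where "\<And>e. e \<in> E \<Longrightarrow> dist k e \<le> C"
      using assms(1) bounded_any_center [of E k] by auto
    ultimately show ?thesis
      using that [of C] infdist_le2 [of k K] by (simp add: dist_commute)
  qed
  have bound: "\<forall>e\<in>E. infdist e K \<le> r ^ n * C" for n
  proof (induction n)
    case (Suc n)
    have "infdist (F i e) K \<le> r ^ Suc n * C" if "e \<in> E" for i e
    proof -
      have "r * infdist e K \<le> r * (r ^ n * C)"
        using Suc that r_nonneg by (intro mult_left_mono) auto
      then show ?thesis
        using infdist_image_le [OF assms(4,3), of i e] by (simp add: mult.assoc)
    qed
    then have "(\<Union>i. F i ` E) \<subseteq> {x. infdist x K \<le> r ^ Suc n * C}"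
      by blast
    moreover have "closed {x. infdist x K \<le> r ^ Suc n * C}"
      by (intro closed_Collect_le continuous_intros)
    ultimately have "closure (\<Union>i. F i ` E) \<subseteq> {x. infdist x K \<le> r ^ Suc n * C}"
      by (rule closure_minimal)
    then show ?case
      using assms(2) by blast
  qed (use C in auto)
  fix e assume "e \<in> E"
  have "(\<lambda>n. r ^ n * C) \<longlonglongrightarrow> 0"
    using r_nonneg r_less_1 by (intro tendsto_mult_left_zero LIMSEQ_power_zero) simp
  then have "infdist e K \<le> 0"
    using bound \<open>e \<in> E\<close> by (intro LIMSEQ_le_const) auto
  then show "e \<in> closure K"
    using assms(3) infdist_nonneg [of e K] by (simp add: in_closure_iff_infdist_zero)
qed

lemma bounded_invariant_subset:
  assumes "bounded E" "invariant_set F E" "invariant_set F K"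
  shows "E \<subseteq> K"
proof -
  have E: "E \<subseteq> closure (\<Union>i. F i ` E)"
    using assms(2) unfolding invariant_set_def by blast
  have K: "K \<noteq> {}" "K = closure (\<Union>i. F i ` K)"
    using assms(3) unfolding invariant_set_def by blast+
  have "F i ` K \<subseteq> closure (\<Union>i. F i ` K)" for i
    by (rule subset_trans [OF _ closure_subset]) blast
  then have "F i ` K \<subseteq> K" for i
    using K(2) by simp
  then have "E \<subseteq> closure K"
    by (rule covered_subset_closure_of_forward_invariant [OF assms(1) E K(1)])
  moreover have "closed K"
    by (subst K(2)) (rule closed_closure)
  ultimately show ?thesis
    by simp
qed

end

section \<open>The supremum of the Lipschitz constants as a contraction factor\<close>

text \<open>The admissible constants form a closed non-empty set bounded below by zero, which therefore
  contains its infimum.\<close>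

lemma Lip_least:
  assumes "c-lipschitz_on UNIV f"
  shows lipschitz_on_Lip: "(Lip f)-lipschitz_on UNIV f"
    and Lip_le: "Lip f \<le> c"
proof -
  define S where "S = {c. c-lipschitz_on UNIV f}"
  have S_iff: "c \<in> S \<longleftrightarrow> 0 \<le> c \<and> (\<forall>x y. dist (f x) (f y) \<le> c * dist x y)" for c
    unfolding S_def lipschitz_on_def by simp
  have "S = {0..} \<inter> (\<Inter>x. \<Inter>y. {c. dist (f x) (f y) \<le> c * dist x y})"
    using S_iff by auto
  also have "closed \<dots>"
    by (intro closed_Int closed_INT ballI closed_Collect_le continuous_intros closed_atLeast)
  finally have "closed S" .
  moreover have bdd: "bdd_below S"
    using S_iff by (auto intro: bdd_belowI [of _ 0])
  moreover have "c \<in> S"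
    using assms unfolding S_def by simp
  ultimately have Inf_mem: "Inf S \<in> S"
    using closed_contains_Inf by blast
  have Inf_le: "Inf S \<le> b" if "b-lipschitz_on UNIV f" for b
    using bdd that unfolding S_def by (intro cInf_lower) auto
  have "Lip f = Inf S"
    unfolding Lip_def using Inf_mem Inf_le by (intro Least_equality) (auto simp: S_def)
  then show "(Lip f)-lipschitz_on UNIV f" "Lip f \<le> c"
    using Inf_mem Inf_le [OF assms] unfolding S_def by auto
qed

lemma uniform_contractions_SUP_Lip:
  fixes F :: "nat \<Rightarrow> 'a::complete_space \<Rightarrow> 'a"
  assumes "\<And>i. contraction_map (F i)" "(SUP i. Lip (F i)) < 1"
  shows "uniform_contractions F (SUP i. Lip (F i))"
proof -
  have ex: "\<exists>c<1. c-lipschitz_on UNIV (F i)" for i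
    using assms(1) [of i] unfolding contraction_map_def lipschitz_on_def
    by (metis less_imp_le)
  then have lipschitz: "(Lip (F i))-lipschitz_on UNIV (F i)" for i
    using lipschitz_on_Lip by blast
  have "Lip (F i) \<le> 1" for i
    using ex [of i] Lip_le by (metis less_imp_le order_trans)
  then have "bdd_above (range (\<lambda>i. Lip (F i)))"
    by (intro bdd_aboveI) auto
  then have upper: "Lip (F i) \<le> (SUP i. Lip (F i))" for i
    by (intro cSUP_upper) auto
  show ?thesis
  proof
    show "0 \<le> (SUP i. Lip (F i))"
      using lipschitz_on_nonneg [OF lipschitz [of 0]] upper [of 0] by linarith
    show "dist (F i x) (F i y) \<le> (SUP i. Lip (F i)) * dist x y" for i x y
      using lipschitz_onD [OF lipschitz_on_le [OF lipschitz upper]] by blast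
  qed (rule assms(2))
qed

section \<open>The unique bounded invariant set\<close>

theorem corollary2p5:
  fixes F :: "nat \<Rightarrow> 'a::complete_space \<Rightarrow> 'a"
  assumes "\<And>i. contraction_map (F i)"
    and "(SUP i. Lip (F i)) < 1"
    and "bounded (fixed_points F)"
  shows "bounded (closure (composition_fixed_points F)) \<and>
         invariant_set F (closure (composition_fixed_points F)) \<and>
         (\<forall>E. bounded E \<and> invariant_set F E \<longrightarrow> E = closure (composition_fixed_points F))"
proof -
  interpret uniform_contractions F "SUP i. Lip (F i)"
    using assms(1,2) by (rule uniform_contractions_SUP_Lip)
  have "bounded (composition_fixed_points F)"
    using assms(3) by (rule bounded_composition_fixed_points)
  then have "bounded (closure (composition_fixed_points F))"
    and "invariant_set F (closure (composition_fixed_points F))"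
    by (auto intro: invariant_set_closure_composition_fixed_points)
  then show ?thesis
    using bounded_invariant_subset by (blast intro: subset_antisym)
qed

end
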